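(* Let $\mathbb{K}$ be a field of characteristic $0$, let $n\ge0$, $m\ge1$, $d_1\ge1$, $d_2\ge2$ be integers, and let $$f=\sum_{r=0}^n x_r^{d_1}g_r\in S_{(d_1,d_2)},\qquad g_r=u_{r_1}\cdots u_{r_{d_2}},$$ be a simplicial Nagata polynomial with associated simplicial complex $\Delta_f$. Then the ideal $I=\mathrm{Ann}(f)\subset T$ is generated by: 1. $X_iX_j$ and $X_k^{d_1+1}$, for $i,j,k\in\{0,\dots,n\}$, $i<j$; 2. $U_1^2,\dots,U_m^2$; 3. the monomials $U_{s_1}\cdots U_{s_j}$, where $\{u_{s_1},\dots,u_{s_j}\}$ is a (minimal) $(j-1)$-cell of the simplex $2^{\{u_1,\dots,u_m\}}$ not contained in $\Delta_f$, for $j\in\{1,\dots,d_2\}$; 4. the monomials $X_rU_i$, where $u_i$ does not divide $g_r$ (i.e. $\{u_i\}\notin\Delta_{g_r}$); 5. the binomials $X_r^{d_1}U_{\rho_1}\cdots U_{\rho_j}-X_s^{d_1}U_{\sigma_1}\cdots U_{\sigma_j}$ such that, setting $g_{r,s}=\gcd(g_r,g_s)$, one has $g_r=u_{\rho_1}\cdots u_{\rho_j}\,g_{r,s}$ and $g_s=u_{\sigma_1}\cdots u_{\sigma_j}\,g_{r,s}$ (i.e. $g_{r,s}$ represents the $(d_2-j-1)$-face given by the intersection of the facets of $g_r$ and $g_s$: $\Delta_{g_{r,s}}=\Delta_{g_r}\cap\Delta_{g_s}$).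
   Context: $S=\mathbb{K}[x_0,\dots,x_n,u_1,\dots,u_m]$ is bigraded with $\deg x_i=(1,0)$, $\deg u_j=(0,1)$, and $T=\mathbb{K}[X_0,\dots,X_n,U_1,\dots,U_m]$ is the bigraded ring of differential operators on $S$, with $X_i=\partial/\partial x_i$ and $U_j=\partial/\partial u_j$. $S_{(d_1,d_2)}$ is the space of bihomogeneous polynomials of bidegree $(d_1,d_2)$. $\mathrm{Ann}(f)=\{\alpha\in T\mid \alpha(f)=0\}$. A simplicial Nagata polynomial of degree $d_1\geq 1$ is $f=\sum_{i=0}^n x_i^{d_1}g_i\in S_{(d_1,d_2)}$ where the $g_i\in\mathbb{K}[u_1,\dots,u_m]$ are linearly independent square-free monomials of degree $d_2\ge2$. A square-free monomial $u_{i_1}\cdots u_{i_d}$ corresponds to the $(d-1)$-dimensional face (or $(d-1)$-cell) $\{u_{i_1},\dots,u_{i_d}\}$ of the simplex $2^{\{u_1,\dots,u_m\}}$. For each $r$, $\Delta_{g_r}$ is the simplex on the set of variables dividing $g_r$, and $\Delta_f$ is the simplicial complex whose facets are the $\Delta_{g_r}$: its faces are the nonempty subsets of $\{u_1,\dots,u_m\}$ contained in the set of variables of some $g_r$. "Minimal" means minimal with respect to inclusion among the nonempty subsets of $\{u_1,\dots,u_m\}$ that are not faces of $\Delta_f$.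
   Formalization: In item 3 the range of j is {1,…,d_2+1} instead of {1,…,d_2}; as printed the claim fails, e.g. for f = x_0^{d_1}u_1u_2 + x_1^{d_1}u_1u_3 + x_2^{d_1}u_2u_3, where U_1U_2U_3 lies in Ann(f) but not in the ideal generated by the printed list. *)

theory Defs
  imports Complex_Main "HOL-Library.Poly_Mapping"
begin

text \<open>
  The variables \<open>x\<^sub>0, \<dots>, x\<^sub>n\<close> are indexed by a finite type \<open>'i\<close> (with \<open>n + 1 = CARD('i)\<close>) and
  \<open>u\<^sub>1, \<dots>, u\<^sub>m\<close> by a finite type \<open>'j\<close> (with \<open>m = CARD('j)\<close>). As commutative rings \<open>S\<close> and \<open>T\<close> are
  both polynomial rings in variables indexed by \<open>'i + 'j\<close>, so one type serves for both: \<open>xvar i\<close> is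
  \<open>x\<^sub>i\<close> in \<open>S\<close> and \<open>X\<^sub>i\<close> in \<open>T\<close>, and \<open>uvar j\<close> is \<open>u\<^sub>j\<close> in \<open>S\<close> and \<open>U\<^sub>j\<close> in \<open>T\<close>. An element of \<open>T\<close> acts
  on \<open>S\<close> through \<open>diffop\<close>.
\<close>

type_synonym ('i, 'j, 'k) bipoly = "(('i + 'j) \<Rightarrow>\<^sub>0 nat) \<Rightarrow>\<^sub>0 'k"

definition const :: "'k::zero \<Rightarrow> ('i, 'j, 'k) bipoly" where
  "const c = Poly_Mapping.single 0 c"

definition xvar :: "'i \<Rightarrow> ('i, 'j, 'k::zero_neq_one) bipoly" where
  "xvar i = Poly_Mapping.single (Poly_Mapping.single (Inl i) 1) 1"

definition uvar :: "'j \<Rightarrow> ('i, 'j, 'k::zero_neq_one) bipoly" where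
  "uvar j = Poly_Mapping.single (Poly_Mapping.single (Inr j) 1) 1"

text \<open>
  Partial derivative with respect to the variable \<open>v\<close>. The truncated subtraction of exponents at
  \<open>lookup s v = 0\<close> is harmless because the coefficient vanishes there.
\<close>

definition pderiv_var :: "'i + 'j \<Rightarrow> ('i, 'j, 'k::comm_ring_1) bipoly \<Rightarrow> ('i, 'j, 'k) bipoly" where
  "pderiv_var v p = (\<Sum>s\<in>Poly_Mapping.keys p.
     Poly_Mapping.single (s - Poly_Mapping.single v 1)
       (of_nat (Poly_Mapping.lookup s v) * Poly_Mapping.lookup p s))"

text \<open>
  The monomial with exponent vector \<open>t\<close> acts as the composition of the
  \<open>(\<partial>/\<partial>v) ^ (lookup t v)\<close>; \<open>pderiv_var_power_fold\<close> below shows that the order of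
  composition is irrelevant.
\<close>

definition diffmon ::
    "(('i::finite + 'j::finite) \<Rightarrow>\<^sub>0 nat) \<Rightarrow> ('i, 'j, 'k::comm_ring_1) bipoly \<Rightarrow> ('i, 'j, 'k) bipoly" where
  "diffmon t = Finite_Set.fold (\<lambda>v D. (pderiv_var v ^^ Poly_Mapping.lookup t v) \<circ> D) id UNIV"

definition diffop ::
    "('i::finite, 'j::finite, 'k::comm_ring_1) bipoly \<Rightarrow> ('i, 'j, 'k) bipoly \<Rightarrow> ('i, 'j, 'k) bipoly" where
  "diffop \<alpha> f = (\<Sum>t\<in>Poly_Mapping.keys \<alpha>. const (Poly_Mapping.lookup \<alpha> t) * diffmon t f)"

definition Ann :: "('i::finite, 'j::finite, 'k::comm_ring_1) bipoly \<Rightarrow> ('i, 'j, 'k) bipoly set" where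
  "Ann f = {\<alpha>. diffop \<alpha> f = 0}"

definition ideal_gen :: "'a::comm_ring_1 set \<Rightarrow> 'a set" where
  "ideal_gen G = module.span (*) G"

definition umono :: "'j set \<Rightarrow> ('i, 'j, 'k::comm_ring_1) bipoly" where
  "umono A = (\<Prod>j\<in>A. uvar j)"

definition simplicial_nagata ::
    "nat \<Rightarrow> nat \<Rightarrow> ('i::finite \<Rightarrow> ('i, 'j::finite, 'k::field) bipoly) \<Rightarrow> ('i, 'j, 'k) bipoly \<Rightarrow> bool" where
  "simplicial_nagata d1 d2 g f \<longleftrightarrow>
     1 \<le> d1 \<and> 2 \<le> d2 \<and>
     (\<forall>r. \<exists>A. card A = d2 \<and> g r = umono A) \<and>
     (\<forall>c. (\<Sum>r\<in>UNIV. const (c r) * g r) = 0 \<longrightarrow> (\<forall>r. c r = 0)) \<and>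
     f = (\<Sum>r\<in>UNIV. xvar r ^ d1 * g r)"

text \<open>Cells are sets of indices: \<open>A\<close> stands for \<open>{u\<^sub>j | j \<in> A}\<close>.\<close>

definition usupp :: "('i, 'j, 'k::comm_ring_1) bipoly \<Rightarrow> 'j set" where
  "usupp h = {j. uvar j dvd h}"

definition complex_faces :: "('i \<Rightarrow> ('i, 'j, 'k::comm_ring_1) bipoly) \<Rightarrow> 'j set set" where
  "complex_faces g = {A. A \<noteq> {} \<and> (\<exists>r. A \<subseteq> usupp (g r))}"

text \<open>
  If all facets have \<open>d2\<close> elements then a minimal nonface has at most \<open>d2 + 1\<close> elements, and this
  bound is attained: for \<open>x\<^sub>0 u\<^sub>1 u\<^sub>2 + x\<^sub>1 u\<^sub>1 u\<^sub>3 + x\<^sub>2 u\<^sub>2 u\<^sub>3\<close> the only minimal nonface is \<open>{1, 2, 3}\<close>.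
\<close>

definition minimal_nonface :: "('i \<Rightarrow> ('i, 'j, 'k::comm_ring_1) bipoly) \<Rightarrow> 'j set \<Rightarrow> bool" where
  "minimal_nonface g A \<longleftrightarrow> A \<noteq> {} \<and> A \<notin> complex_faces g \<and>
     (\<forall>B. B \<noteq> {} \<and> B \<subset> A \<longrightarrow> B \<in> complex_faces g)"

text \<open>Polynomials over a field are not an instance of the gcd type classes here.\<close>

definition is_gcd :: "'a::comm_ring_1 \<Rightarrow> 'a \<Rightarrow> 'a \<Rightarrow> bool" where
  "is_gcd h a b \<longleftrightarrow> h dvd a \<and> h dvd b \<and> (\<forall>e. e dvd a \<and> e dvd b \<longrightarrow> e dvd h)"

lemma module_times: "module ((*) :: 'a::comm_ring_1 \<Rightarrow> 'a \<Rightarrow> 'a)"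
  by unfold_locales (simp_all add: algebra_simps)

lemma const_1: "const 1 = 1"
  by (simp add: const_def)

lemma lookup_pderiv_var:
  "Poly_Mapping.lookup (pderiv_var v p) s =
     of_nat (Suc (Poly_Mapping.lookup s v)) * Poly_Mapping.lookup p (s + Poly_Mapping.single v 1)"
proof -
  let ?e = "Poly_Mapping.single v (1::nat)"
  let ?c = "of_nat (Suc (Poly_Mapping.lookup s v)) * Poly_Mapping.lookup p (s + ?e)"
  have eq: "Poly_Mapping.lookup (Poly_Mapping.single (t - ?e)
        (of_nat (Poly_Mapping.lookup t v) * Poly_Mapping.lookup p t)) s = (if t = s + ?e then ?c else 0)" for t
  proof (cases "Poly_Mapping.lookup t v = 0")
    case True
    then have "t \<noteq> s + ?e" by (auto simp: lookup_add)
    with True show ?thesis by simp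
  next
    case False
    then have "t - ?e = s \<longleftrightarrow> t = s + ?e"
      by (auto simp: poly_mapping_eq_iff fun_eq_iff lookup_add lookup_minus lookup_single when_def
          split: if_splits)
    then show ?thesis by (auto simp: lookup_single when_def lookup_add)
  qed
  have "Poly_Mapping.lookup (pderiv_var v p) s
      = (\<Sum>t\<in>Poly_Mapping.keys p. if t = s + ?e then ?c else 0)"
    unfolding pderiv_var_def lookup_sum eq ..
  also have "\<dots> = (if s + ?e \<in> Poly_Mapping.keys p then ?c else 0)"
    by (simp add: sum.delta)
  also have "\<dots> = ?c" by (simp add: in_keys_iff)
  finally show ?thesis .
qed

lemma pderiv_var_commute: "pderiv_var v (pderiv_var w p) = pderiv_var w (pderiv_var v p)"
proof (cases "v = w")
  case False
  then show ?thesis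
    by (intro poly_mapping_eqI)
       (simp add: lookup_pderiv_var lookup_add lookup_single ac_simps)
qed simp

lemma pderiv_var_power_fold:
  fixes t :: "('i::finite + 'j::finite) \<Rightarrow>\<^sub>0 nat"
  shows "comp_fun_commute (\<lambda>v (D :: ('i, 'j, 'k::comm_ring_1) bipoly \<Rightarrow> ('i, 'j, 'k) bipoly).
    (pderiv_var v ^^ Poly_Mapping.lookup t v) \<circ> D)"
proof
  fix v w :: "'i + 'j"
  have 1: "(pderiv_var v ^^ a) (pderiv_var w p) = pderiv_var w ((pderiv_var v ^^ a) p)"
    for a and p :: "('i, 'j, 'k) bipoly"
    by (induction a) (simp_all add: pderiv_var_commute)
  have "(pderiv_var v ^^ a) ((pderiv_var w ^^ b) p) = (pderiv_var w ^^ b) ((pderiv_var v ^^ a) p)"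
    for a b and p :: "('i, 'j, 'k) bipoly"
    by (induction b) (simp_all add: 1)
  then show "(\<lambda>D :: ('i, 'j, 'k) bipoly \<Rightarrow> ('i, 'j, 'k) bipoly.
        (pderiv_var w ^^ Poly_Mapping.lookup t w) \<circ> D) \<circ>
        (\<lambda>D. (pderiv_var v ^^ Poly_Mapping.lookup t v) \<circ> D) =
      (\<lambda>D. (pderiv_var v ^^ Poly_Mapping.lookup t v) \<circ> D) \<circ>
        (\<lambda>D. (pderiv_var w ^^ Poly_Mapping.lookup t w) \<circ> D)"
    by (simp add: fun_eq_iff)
qed

lemma diffmon_single:
  fixes w :: "'i::finite + 'j::finite"
  shows "diffmon (Poly_Mapping.single w 1) =
    (pderiv_var w :: ('i, 'j, 'k::comm_ring_1) bipoly \<Rightarrow> _)"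
proof -
  let ?F = "\<lambda>v (D :: ('i, 'j, 'k) bipoly \<Rightarrow> ('i, 'j, 'k) bipoly). (pderiv_var v ^^ Poly_Mapping.lookup (Poly_Mapping.single w 1) v) \<circ> D"
  interpret comp_fun_commute ?F by (rule pderiv_var_power_fold)
  have *: "finite A \<Longrightarrow> w \<notin> A \<Longrightarrow> Finite_Set.fold ?F id A = id" for A
  proof (induction A rule: finite_induct)
    case (insert x A)
    then have "Finite_Set.fold ?F id (insert x A) = ?F x (Finite_Set.fold ?F id A)"
      by (intro fold_insert) auto
    also have "Finite_Set.fold ?F id A = id"
      using insert by blast
    finally show ?case
      using insert by (simp add: lookup_single when_def)
  qed simp
  have "(diffmon (Poly_Mapping.single w 1) :: ('i, 'j, 'k) bipoly \<Rightarrow> _) = ?F w (Finite_Set.fold ?F id (UNIV - {w}))"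
    unfolding diffmon_def by (rule fold_rec) auto
  also have "\<dots> = pderiv_var w" by (subst *) auto
  finally show ?thesis .
qed

lemma diffop_xvar: "diffop (xvar i) f = pderiv_var (Inl i) f"
  and diffop_uvar: "diffop (uvar j) f = pderiv_var (Inr j) f"
  by (simp_all add: diffop_def xvar_def uvar_def const_1 diffmon_single[unfolded One_nat_def])

end

theory Submission
  imports Defs
begin

text \<open>
  Write \<open>f\<close> as the sum of the monomials with exponents \<open>m\<^sub>r = d\<^sub>1 e\<^sub>r + 1\<^bsub>G r\<^esub>\<close>. All the products of
  factorials \<open>m\<^sub>r!\<close> equal \<open>d\<^sub>1!\<close>, so in characteristic 0 an operator \<open>\<alpha>\<close> kills \<open>f\<close> iff for every
  exponent \<open>s\<close> the coefficients of \<open>\<alpha>\<close> at the exponents \<open>m\<^sub>r - s\<close>, with \<open>r\<close> ranging over the indices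
  such that \<open>s \<le> m\<^sub>r\<close>, sum to 0. Modulo the proposed generators, a monomial dividing no \<open>m\<^sub>r\<close>
  vanishes, and \<open>m\<^sub>r - s\<close> and \<open>m\<^sub>q - s\<close> give the same monomial. If \<open>\<alpha>\<close> satisfies the condition
  and \<open>t = m\<^sub>r - s\<close> occurs in \<open>\<alpha>\<close>, then some other \<open>m\<^sub>q - s\<close> occurs as well, so \<open>t\<close> can be removed
  without introducing a new exponent, and induction on the number of terms applies.
\<close>

section \<open>Monomials\<close>

abbreviation mon :: "('a \<Rightarrow>\<^sub>0 nat) \<Rightarrow> ('a \<Rightarrow>\<^sub>0 nat) \<Rightarrow>\<^sub>0 'k::comm_ring_1" where
  "mon t \<equiv> Poly_Mapping.single t 1"

text \<open>Divisibility of monomials. It is kept apart from the lexicographic \<open>\<le>\<close>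
  of finitely supported maps, which depends on a linear order of the variables.\<close>

definition exp_le :: "('a \<Rightarrow>\<^sub>0 nat) \<Rightarrow> ('a \<Rightarrow>\<^sub>0 nat) \<Rightarrow> bool" where
  "exp_le s t \<longleftrightarrow> (\<forall>v. Poly_Mapping.lookup s v \<le> Poly_Mapping.lookup t v)"

lemma exp_le_add_diff: "exp_le s t \<Longrightarrow> s + (t - s) = t"
  by (auto simp: exp_le_def poly_mapping_eq_iff fun_eq_iff lookup_add lookup_minus)

lemma exp_le_add: "exp_le s (s + t)"
  by (simp add: exp_le_def lookup_add)

lemma poly_mapping_sum_singles:
  "(\<Sum>k\<in>Poly_Mapping.keys p. Poly_Mapping.single k (Poly_Mapping.lookup p k)) = p"
  for p :: "'a \<Rightarrow>\<^sub>0 'b::comm_monoid_add"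
  by (rule poly_mapping_eqI) (auto simp: lookup_sum lookup_single when_def sum.delta' in_keys_iff)

lemma add_eq_exp_iff: "t + s = u \<longleftrightarrow> t = u - s \<and> exp_le s u"
  using exp_le_add_diff[of s u] exp_le_add[of s t] by (auto simp: add.commute)

text \<open>Only the term of \<open>p\<close> at \<open>s - t\<close> can land on \<open>s\<close>.
  The test \<open>exp_le t s\<close> excludes exponents where the truncated subtraction has no
  meaning.\<close>

lemma lookup_single_times:
  fixes p :: "('a \<Rightarrow>\<^sub>0 nat) \<Rightarrow>\<^sub>0 'k::comm_ring_1"
  shows "Poly_Mapping.lookup (Poly_Mapping.single t c * p) s =
    (if exp_le t s then c * Poly_Mapping.lookup p (s - t) else 0)"
proof -
  have eq: "Poly_Mapping.lookup (Poly_Mapping.single (t + k) v) s =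
      (if k = s - t then if exp_le t s then v else 0 else 0)" for k and v :: 'k
    using exp_le_add_diff[of t s] by (auto simp: lookup_single when_def exp_le_add)
  have "Poly_Mapping.single t c * p =
      Poly_Mapping.single t c * (\<Sum>k\<in>Poly_Mapping.keys p. Poly_Mapping.single k (Poly_Mapping.lookup p k))"
    by (subst poly_mapping_sum_singles) simp
  also have "\<dots> = (\<Sum>k\<in>Poly_Mapping.keys p. Poly_Mapping.single (t + k) (c * Poly_Mapping.lookup p k))"
    by (simp add: sum_distrib_left mult_single)
  finally show ?thesis
    by (simp add: lookup_sum eq sum.delta' in_keys_iff)
qed

lemma lookup_single_times_add:
  fixes p :: "('a \<Rightarrow>\<^sub>0 nat) \<Rightarrow>\<^sub>0 'k::comm_ring_1"
  shows "Poly_Mapping.lookup (Poly_Mapping.single t c * p) (t + s) = c * Poly_Mapping.lookup p s"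
  by (simp add: lookup_single_times exp_le_add)

lemma single_dvd_single_iff:
  fixes c d :: "'k::field"
  assumes "c \<noteq> 0" "d \<noteq> 0"
  shows "Poly_Mapping.single s c dvd Poly_Mapping.single t d \<longleftrightarrow> exp_le s t"
proof
  assume "Poly_Mapping.single s c dvd Poly_Mapping.single t d"
  then obtain p where "Poly_Mapping.single t d = Poly_Mapping.single s c * p" ..
  then have "Poly_Mapping.lookup (Poly_Mapping.single s c * p) t = d"
    by (metis lookup_single_eq)
  with assms show "exp_le s t"
    by (auto simp: lookup_single_times split: if_splits)
next
  assume "exp_le s t"
  with assms have "Poly_Mapping.single t d = Poly_Mapping.single s c * Poly_Mapping.single (t - s) (d / c)"
    by (simp add: mult_single exp_le_add_diff)
  then show "Poly_Mapping.single s c dvd Poly_Mapping.single t d" ..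
qed

text \<open>Multiplication by \<open>mon s\<close> shifts the coefficient at \<open>w\<close> to
  \<open>s + w\<close>, so the cofactor can be read off.\<close>

lemma mon_times_eq_imp:
  fixes p :: "('a \<Rightarrow>\<^sub>0 nat) \<Rightarrow>\<^sub>0 'k::field"
  assumes "mon t = mon s * p"
  shows "exp_le s t" and "p = mon (t - s)"
proof -
  from assms have "mon s dvd (mon t :: ('a \<Rightarrow>\<^sub>0 nat) \<Rightarrow>\<^sub>0 'k)" ..
  then show le: "exp_le s t"
    by (simp add: single_dvd_single_iff)
  show "p = mon (t - s)"
  proof (rule poly_mapping_eqI)
    fix w
    have "Poly_Mapping.lookup p w = Poly_Mapping.lookup (mon t) (s + w)"
      using lookup_single_times_add[of s 1 p w] by (simp add: assms)
    also have "t = s + w \<longleftrightarrow> t - s = w"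
      using exp_le_add_diff[OF le] by auto
    then have "Poly_Mapping.lookup (mon t) (s + w) = (Poly_Mapping.lookup (mon (t - s)) w :: 'k)"
      by (simp add: lookup_single when_def)
    finally show "Poly_Mapping.lookup p w = Poly_Mapping.lookup (mon (t - s)) w" .
  qed
qed

lemma prod_single_one:
  "finite A \<Longrightarrow> (\<Prod>a\<in>A. mon (h a)) = (mon (\<Sum>a\<in>A. h a) :: ('a \<Rightarrow>\<^sub>0 nat) \<Rightarrow>\<^sub>0 'k::comm_ring_1)"
  by (induction A rule: finite_induct) (simp_all add: mult_single)

lemma single_one_power:
  "(mon (Poly_Mapping.single v 1) :: ('a \<Rightarrow>\<^sub>0 nat) \<Rightarrow>\<^sub>0 'k::comm_ring_1) ^ n = mon (Poly_Mapping.single v n)"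
  by (induction n) (simp_all add: mult_single single_add[symmetric])

section \<open>Square-free monomials and their exponents\<close>

definition squarefree_exp :: "'j set \<Rightarrow> ('i + 'j) \<Rightarrow>\<^sub>0 nat" where
  "squarefree_exp A = (\<Sum>j\<in>A. Poly_Mapping.single (Inr j) 1)"

lemma lookup_squarefree_exp:
  fixes A :: "'j::finite set"
  shows "Poly_Mapping.lookup (squarefree_exp A :: ('i + 'j) \<Rightarrow>\<^sub>0 nat) (Inl i) = 0"
    and "Poly_Mapping.lookup (squarefree_exp A :: ('i + 'j) \<Rightarrow>\<^sub>0 nat) (Inr j) = (if j \<in> A then 1 else 0)"
  by (simp_all add: squarefree_exp_def lookup_sum lookup_single when_def)

lemma squarefree_exp_subset: "A \<subseteq> B \<Longrightarrow> squarefree_exp B = squarefree_exp A + squarefree_exp (B - A)"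
  for A B :: "'j::finite set"
  using sum.subset_diff[of A B] by (simp add: squarefree_exp_def add.commute)

lemma umono_eq_single: "umono A = mon (squarefree_exp A)" for A :: "'j::finite set"
  by (simp add: umono_def uvar_def prod_single_one squarefree_exp_def)

lemma xvar_times_eq_single:
  shows "xvar i * xvar j = mon (Poly_Mapping.single (Inl i) 1 + Poly_Mapping.single (Inl j) 1)"
    and "xvar i * uvar l = mon (Poly_Mapping.single (Inl i) 1 + Poly_Mapping.single (Inr l) 1)"
  by (simp_all add: xvar_def uvar_def mult_single)

lemma xvar_power_eq_single: "xvar i ^ n = mon (Poly_Mapping.single (Inl i) n)"
  unfolding xvar_def by (rule single_one_power)

lemma uvar_power_eq_single: "uvar j ^ n = mon (Poly_Mapping.single (Inr j) n)"
  unfolding uvar_def by (rule single_one_power)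

section \<open>The annihilator in terms of coefficients\<close>

text \<open>Iterated differentiation produces the quotient of the factorials of the new and the old
  exponent of \<open>v\<close>. Clearing the denominator makes the induction telescope.\<close>

lemma fact_times_lookup_funpow_pderiv_var:
  fixes p :: "('i, 'j, 'k::field_char_0) bipoly"
  shows "fact (Poly_Mapping.lookup s v) * Poly_Mapping.lookup ((pderiv_var v ^^ n) p) s =
    fact (Poly_Mapping.lookup s v + n) * Poly_Mapping.lookup p (s + Poly_Mapping.single v n)"
proof (induction n arbitrary: s)
  case (Suc n)
  have "fact (Poly_Mapping.lookup s v) * Poly_Mapping.lookup ((pderiv_var v ^^ Suc n) p) s =
      fact (Poly_Mapping.lookup (s + Poly_Mapping.single v 1) v) *
      Poly_Mapping.lookup ((pderiv_var v ^^ n) p) (s + Poly_Mapping.single v 1)"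
    by (simp add: lookup_pderiv_var lookup_add algebra_simps)
  also note Suc
  finally show ?case
    by (simp add: lookup_add add.assoc single_add[symmetric])
qed simp

text \<open>The multi-index factorial \<open>s!\<close>.\<close>

definition fact_exp :: "(('a::finite) \<Rightarrow>\<^sub>0 nat) \<Rightarrow> 'k::field_char_0" where
  "fact_exp s = (\<Prod>v\<in>UNIV. fact (Poly_Mapping.lookup s v))"

lemma sum_single_lookup: "(\<Sum>v\<in>UNIV. Poly_Mapping.single v (Poly_Mapping.lookup t v)) = t"
  for t :: "'a::finite \<Rightarrow>\<^sub>0 nat"
  by (rule poly_mapping_eqI) (simp add: lookup_sum lookup_single when_def)

text \<open>The one-variable formula is applied variable by variable along the fold. The exponent
  \<open>s\<close> stays arbitrary in the induction because each variable shifts it.\<close>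

lemma fact_exp_times_lookup_diffmon:
  fixes p :: "('i::finite, 'j::finite, 'k::field_char_0) bipoly"
  shows "fact_exp s * Poly_Mapping.lookup (diffmon t p) s = fact_exp (s + t) * Poly_Mapping.lookup p (s + t)"
proof -
  let ?F = "\<lambda>v (D :: ('i, 'j, 'k) bipoly \<Rightarrow> ('i, 'j, 'k) bipoly). (pderiv_var v ^^ Poly_Mapping.lookup t v) \<circ> D"
  interpret comp_fun_commute ?F by (rule pderiv_var_power_fold)
  have "(\<Prod>v\<in>A. fact (Poly_Mapping.lookup s v)) * Poly_Mapping.lookup (Finite_Set.fold ?F id A p) s =
     (\<Prod>v\<in>A. fact (Poly_Mapping.lookup (s + t) v)) *
     Poly_Mapping.lookup p (s + (\<Sum>v\<in>A. Poly_Mapping.single v (Poly_Mapping.lookup t v)))" if "finite A" for A s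
    using that
  proof (induction A arbitrary: s rule: finite_induct)
    case (insert v A)
    let ?e = "Poly_Mapping.single v (Poly_Mapping.lookup t v)"
    \<comment> \<open>The shift by \<open>?e\<close> touches only \<open>v\<close>, which lies
      outside \<open>A\<close>.\<close>
    have off: "(\<Prod>w\<in>A. h (Poly_Mapping.lookup (s + ?e) w)) = (\<Prod>w\<in>A. h (Poly_Mapping.lookup s w))" for h :: "nat \<Rightarrow> 'k"
      using insert.hyps by (intro prod.cong) (auto simp: lookup_add lookup_single when_def)
    have off2: "(\<Prod>w\<in>A. fact (Poly_Mapping.lookup (s + ?e + t) w)) = (\<Prod>w\<in>A. fact (Poly_Mapping.lookup (s + t) w) :: 'k)"
      using insert.hyps by (intro prod.cong) (auto simp: lookup_add lookup_single when_def)
    have "(\<Prod>w\<in>insert v A. fact (Poly_Mapping.lookup s w)) * Poly_Mapping.lookup (Finite_Set.fold ?F id (insert v A) p) s =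
      (\<Prod>w\<in>A. fact (Poly_Mapping.lookup s w)) * (fact (Poly_Mapping.lookup s v) *
        Poly_Mapping.lookup ((pderiv_var v ^^ Poly_Mapping.lookup t v) (Finite_Set.fold ?F id A p)) s)"
      using insert.hyps by (simp add: algebra_simps)
    also have "\<dots> = fact (Poly_Mapping.lookup (s + t) v) *
       ((\<Prod>w\<in>A. fact (Poly_Mapping.lookup (s + ?e) w)) * Poly_Mapping.lookup (Finite_Set.fold ?F id A p) (s + ?e))"
      unfolding fact_times_lookup_funpow_pderiv_var off by (simp add: algebra_simps lookup_add)
    also note insert.IH
    finally show ?case
      unfolding off2 using insert.hyps by (simp add: algebra_simps)
  qed simp
  from this[of UNIV s, OF finite] show ?thesis
    by (simp add: sum_single_lookup fact_exp_def diffmon_def)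
qed

text \<open>Weighting the coefficients by factorials turns differentiation into contraction.\<close>

lemma lookup_diffop:
  fixes f :: "('i::finite, 'j::finite, 'k::field_char_0) bipoly"
  shows "fact_exp s * Poly_Mapping.lookup (diffop \<alpha> f) s =
    (\<Sum>t\<in>Poly_Mapping.keys \<alpha>. Poly_Mapping.lookup \<alpha> t * (fact_exp (s + t) * Poly_Mapping.lookup f (s + t)))"
proof -
  have "exp_le 0 s"
    by (simp add: exp_le_def)
  then have "fact_exp s * Poly_Mapping.lookup (diffop \<alpha> f) s =
      (\<Sum>t\<in>Poly_Mapping.keys \<alpha>. Poly_Mapping.lookup \<alpha> t * (fact_exp s * Poly_Mapping.lookup (diffmon t f) s))"
    by (simp add: diffop_def const_def lookup_sum lookup_single_times sum_distrib_left mult.left_commute)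
  then show ?thesis
    by (simp add: fact_exp_times_lookup_diffmon)
qed

lemma fact_exp_nonzero: "fact_exp s \<noteq> (0 :: 'k::field_char_0)"
  by (simp add: fact_exp_def)

text \<open>
  For \<open>f\<close> the sum of the monomials with exponents \<open>m r\<close>, this says that \<open>\<alpha>\<close> annihilates \<open>f\<close> under
  contraction, the action without the factorials of differentiation.
\<close>

definition apolar :: "('i::finite \<Rightarrow> 'a \<Rightarrow>\<^sub>0 nat) \<Rightarrow> (('a \<Rightarrow>\<^sub>0 nat) \<Rightarrow>\<^sub>0 'k::comm_ring_1) \<Rightarrow> bool" where
  "apolar m \<alpha> \<longleftrightarrow> (\<forall>s. (\<Sum>r | exp_le s (m r). Poly_Mapping.lookup \<alpha> (m r - s)) = 0)"

lemma apolarD: "apolar m \<alpha> \<Longrightarrow> (\<Sum>r | exp_le s (m r). Poly_Mapping.lookup \<alpha> (m r - s)) = 0"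
  by (simp add: apolar_def)

lemma exp_le_diff_iff: "exp_le s u \<and> exp_le t (u - s) \<longleftrightarrow> exp_le (s + t) u"
proof -
  have "a \<le> c \<and> b \<le> c - a \<longleftrightarrow> a + b \<le> c" for a b c :: nat
    by auto
  then show ?thesis
    by (simp add: exp_le_def lookup_minus lookup_add all_conj_distrib[symmetric])
qed

text \<open>The common factorial \<open>c\<close> factors out of each weighted coefficient of the
  derivative, leaving \<open>c\<close> times an apolarity sum. Both \<open>c\<close> and
  \<open>s!\<close> are nonzero in characteristic 0.\<close>

lemma Ann_sum_single:
  fixes m :: "'i::finite \<Rightarrow> ('i + 'j::finite) \<Rightarrow>\<^sub>0 nat"
  assumes fact: "\<And>r. fact_exp (m r) = (c :: 'k::field_char_0)"
  shows "Ann (\<Sum>r\<in>UNIV. mon (m r) :: ('i, 'j, 'k) bipoly) = Collect (apolar m)"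
proof -
  let ?f = "\<Sum>r\<in>UNIV. mon (m r) :: ('i, 'j, 'k) bipoly"
  have c: "c \<noteq> 0"
    using fact_exp_nonzero fact by metis
  have key: "fact_exp s * Poly_Mapping.lookup (diffop \<alpha> ?f) s =
      c * (\<Sum>r | exp_le s (m r). Poly_Mapping.lookup \<alpha> (m r - s))" for s and \<alpha> :: "('i, 'j, 'k) bipoly"
  proof -
    have eq: "(m r = s + t) \<longleftrightarrow> (t = m r - s \<and> exp_le s (m r))" for r t
      using exp_le_add_diff[of s "m r"] by (auto simp: exp_le_add)
    have fact_eq: "m r = s + t \<Longrightarrow> fact_exp (s + t) = c" for r t
      using fact[of r] by simp
    have "fact_exp s * Poly_Mapping.lookup (diffop \<alpha> ?f) s =
        (\<Sum>t\<in>Poly_Mapping.keys \<alpha>. \<Sum>r\<in>UNIV. if m r = s + t then Poly_Mapping.lookup \<alpha> t * c else 0)"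
      unfolding lookup_diffop lookup_sum sum_distrib_left
      by (intro sum.cong refl) (auto simp: lookup_single when_def dest: fact_eq)
    also have "\<dots> = (\<Sum>r\<in>UNIV. \<Sum>t\<in>Poly_Mapping.keys \<alpha>. if t = m r - s then
        (if exp_le s (m r) then Poly_Mapping.lookup \<alpha> t * c else 0) else 0)"
      \<comment> \<open>For fixed \<open>r\<close> at most one exponent \<open>t\<close> satisfies
        \<open>s + t = m r\<close>.\<close>
      by (subst sum.swap) (auto simp: eq intro!: sum.cong)
    also have "\<dots> = (\<Sum>r\<in>UNIV. if exp_le s (m r) then Poly_Mapping.lookup \<alpha> (m r - s) * c else 0)"
      by (intro sum.cong refl) (auto simp: sum.delta' in_keys_iff)
    also have "\<dots> = c * (\<Sum>r | exp_le s (m r). Poly_Mapping.lookup \<alpha> (m r - s))"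
      by (simp add: sum.If_cases sum_distrib_left mult.commute)
    finally show ?thesis .
  qed
  have "diffop \<alpha> ?f = 0 \<longleftrightarrow> (\<forall>s. fact_exp s * Poly_Mapping.lookup (diffop \<alpha> ?f) s = 0)" for \<alpha>
    by (simp add: poly_mapping_eq_iff fun_eq_iff fact_exp_nonzero)
  then show ?thesis
    by (auto simp: Ann_def apolar_def key c)
qed

section \<open>The apolar elements form an ideal\<close>

text \<open>The condition at \<open>s\<close> for the product is \<open>c\<close> times the
  condition at \<open>s + t\<close> for \<open>\<alpha>\<close>.\<close>

lemma apolar_single_times:
  assumes "apolar m \<alpha>"
  shows "apolar m (Poly_Mapping.single t c * \<alpha>)"
  unfolding apolar_def
proof
  fix s
  have "(\<Sum>r | exp_le s (m r). Poly_Mapping.lookup (Poly_Mapping.single t c * \<alpha>) (m r - s)) =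
      (\<Sum>r | exp_le s (m r). if exp_le t (m r - s) then c * Poly_Mapping.lookup \<alpha> (m r - (s + t)) else 0)"
    by (intro sum.cong refl) (auto simp: lookup_single_times diff_diff_eq)
  also have "\<dots> = (\<Sum>r | exp_le (s + t) (m r). c * Poly_Mapping.lookup \<alpha> (m r - (s + t)))"
    by (subst sum.inter_filter[symmetric]) (simp_all add: exp_le_diff_iff)
  also have "\<dots> = 0"
    using apolarD[OF assms, of "s + t"] by (simp add: sum_distrib_left[symmetric])
  finally show "(\<Sum>r | exp_le s (m r). Poly_Mapping.lookup (Poly_Mapping.single t c * \<alpha>) (m r - s)) = 0" .
qed

lemma apolar_add: "apolar m \<alpha> \<Longrightarrow> apolar m \<beta> \<Longrightarrow> apolar m (\<alpha> + \<beta>)"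
  by (simp add: apolar_def lookup_add sum.distrib)

lemma apolar_zero: "apolar m 0"
  by (simp add: apolar_def)

lemma apolar_sum: "(\<And>x. x \<in> A \<Longrightarrow> apolar m (h x)) \<Longrightarrow> apolar m (sum h A)"
  by (induction A rule: infinite_finite_induct) (auto intro: apolar_add apolar_zero)

lemma apolar_times: "apolar m \<alpha> \<Longrightarrow> apolar m (\<beta> * \<alpha>)"
  by (subst poly_mapping_sum_singles[of \<beta>, symmetric])
     (auto simp: sum_distrib_right intro!: apolar_sum apolar_single_times)

text \<open>Over the ring itself a subspace is an ideal, so this reduces one inclusion of the
  theorem to the generators.\<close>

lemma subspace_apolar: "module.subspace (*) (Collect (apolar m))"
  by (simp add: module.subspace_def[OF module_times] apolar_zero apolar_add apolar_times)

text \<open>If \<open>t = m r - s\<close> with \<open>s\<close> dividing \<open>m r\<close>, then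
  \<open>t\<close> divides \<open>m r\<close>; so every summand vanishes.\<close>

lemma apolar_single:
  assumes "\<And>r. \<not> exp_le t (m r)"
  shows "apolar m (mon t)"
  unfolding apolar_def
proof (intro allI sum.neutral ballI)
  fix s r assume "r \<in> {r. exp_le s (m r)}"
  then have "m r - s \<noteq> t"
    using assms[of r] exp_le_add_diff[of s "m r"] exp_le_add[of t s] by (auto simp: add.commute)
  then show "Poly_Mapping.lookup (mon t) (m r - s) = 0"
    by (simp add: lookup_single)
qed

text \<open>The reduction in abstract form: \<open>mono\<close> and \<open>bino\<close> are all that
  has to be known about the ideal, and the shape of the exponents enters only through their
  injectivity.\<close>

lemma apolar_in_ideal:
  fixes m :: "'i::finite \<Rightarrow> 'a \<Rightarrow>\<^sub>0 nat" and I :: "(('a \<Rightarrow>\<^sub>0 nat) \<Rightarrow>\<^sub>0 'k::comm_ring_1) set"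
  assumes I: "module.subspace (*) I" "I \<subseteq> Collect (apolar m)"
    and inj: "inj m"
    and mono: "\<And>t. (\<And>r. \<not> exp_le t (m r)) \<Longrightarrow> mon t \<in> I"
    and bino: "\<And>r q s. r \<noteq> q \<Longrightarrow> exp_le s (m r) \<Longrightarrow> exp_le s (m q) \<Longrightarrow> mon (m r - s) - mon (m q - s) \<in> I"
    and "apolar m \<alpha>"
  shows "\<alpha> \<in> I"
  using \<open>apolar m \<alpha>\<close>
proof (induction "card (Poly_Mapping.keys \<alpha>)" arbitrary: \<alpha> rule: less_induct)
  case less
  note I_rules = module.subspace_add[OF module_times I(1)] module.subspace_scale[OF module_times I(1)]
  \<comment> \<open>The support shrinks strictly, and the difference remains apolar since
    \<open>I\<close> consists of apolar elements.\<close>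
  have reduce: "\<alpha> \<in> I" if \<gamma>: "\<gamma> \<in> I" and t: "t \<in> Poly_Mapping.keys \<alpha>"
    and sub: "Poly_Mapping.keys (\<alpha> - \<gamma>) \<subseteq> Poly_Mapping.keys \<alpha> - {t}" for \<gamma> t
  proof -
    have "card (Poly_Mapping.keys (\<alpha> - \<gamma>)) \<le> card (Poly_Mapping.keys \<alpha> - {t})"
      using sub by (intro card_mono) auto
    also have "\<dots> < card (Poly_Mapping.keys \<alpha>)"
      using t by (intro card_Diff1_less) auto
    finally have "card (Poly_Mapping.keys (\<alpha> - \<gamma>)) < card (Poly_Mapping.keys \<alpha>)" .
    moreover have "apolar m (\<alpha> - \<gamma>)"
      using module.subspace_diff[OF module_times subspace_apolar, of \<alpha> m \<gamma>] less.prems \<gamma> I(2) by auto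
    ultimately have "\<alpha> - \<gamma> \<in> I"
      by (rule less.hyps)
    from I_rules(1)[OF this \<gamma>] show ?thesis by simp
  qed
  show ?case
  proof (cases "Poly_Mapping.keys \<alpha> = {}")
    case True
    then show ?thesis
      using module.subspace_0[OF module_times I(1)] by simp
  next
    case False
    then obtain t where t: "t \<in> Poly_Mapping.keys \<alpha>" by blast
    let ?c = "Poly_Mapping.single 0 (Poly_Mapping.lookup \<alpha> t)"
    show ?thesis
    proof (cases "\<exists>r. exp_le t (m r)")
      case False
      then have "?c * mon t \<in> I"
        by (intro I_rules mono) auto
      then show ?thesis
        by (rule reduce[OF _ t]) (auto simp: in_keys_iff lookup_minus mult_single lookup_single when_def split: if_splits)
    next
      case True
      then obtain r where r: "exp_le t (m r)" by blast
      \<comment> \<open>The complement of \<open>t\<close> in \<open>m r\<close>, so that the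
        coefficient at \<open>t\<close> occurs in the apolarity sum at \<open>s\<close>.\<close>
      define s where "s = m r - t"
      have t_eq: "t = m r - s" and s: "exp_le s (m r)"
        using exp_le_add_diff[OF r] exp_le_add[of s t] unfolding s_def
        by (metis add_diff_cancel_right', metis add.commute)
      \<comment> \<open>The whole sum is 0 and its summand at \<open>r\<close> is not.\<close>
      have "(\<Sum>q \<in> {q. exp_le s (m q)} - {r}. Poly_Mapping.lookup \<alpha> (m q - s)) \<noteq> 0"
        using apolarD[OF less.prems, of s] s t
        by (subst (asm) sum.remove[of _ r]) (auto simp: in_keys_iff t_eq[symmetric])
      then obtain q where q: "exp_le s (m q)" "q \<noteq> r" "Poly_Mapping.lookup \<alpha> (m q - s) \<noteq> 0"
        using sum.not_neutral_contains_not_neutral by (metis (mono_tags, lifting) Diff_iff insertCI mem_Collect_eq)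
      \<comment> \<open>Subtracting this element cancels the term at \<open>t\<close> and otherwise
        changes only the coefficient at \<open>m q - s\<close>, which is already in the
        support.\<close>
      have in_I: "?c * (mon t - mon (m q - s)) \<in> I"
        unfolding t_eq by (intro I_rules bino) (use q s in auto)
      \<comment> \<open>Equality would give \<open>m q = m r\<close>, against injectivity.\<close>
      have "m q - s \<noteq> t"
        using exp_le_add_diff[OF s] exp_le_add_diff[OF q(1)] q(2) injD[OF inj] unfolding t_eq by metis
      with q show ?thesis
        by (intro reduce[OF in_I t])
          (auto simp: in_keys_iff lookup_minus lookup_add mult_single algebra_simps lookup_single when_def split: if_splits)
    qed
  qed
qed

section \<open>Divisors of monomials\<close>

text \<open>
  Exponents over an unordered finite index type embed additively into \<open>nat \<Rightarrow>\<^sub>0 nat\<close>, which carries a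
  linear order compatible with addition; a divisor of a monomial then has equal largest and
  smallest exponents.
\<close>

lemma inj_exponent_transfer:
  fixes e :: "'a::finite \<Rightarrow> nat"
  assumes "inj e"
  defines "\<phi> \<equiv> \<lambda>t :: 'a \<Rightarrow>\<^sub>0 nat. \<Sum>v\<in>UNIV. Poly_Mapping.single (e v) (Poly_Mapping.lookup t v)"
  shows "inj \<phi>" and "\<phi> (s + t) = \<phi> s + \<phi> t"
proof -
  have "Poly_Mapping.lookup (\<phi> t) (e v) = Poly_Mapping.lookup t v" for t v
    using assms(1) by (simp add: \<phi>_def lookup_sum lookup_single when_def inj_eq)
  then show "inj \<phi>"
    by (intro injI poly_mapping_eqI) metis
  show "\<phi> (s + t) = \<phi> s + \<phi> t"
    by (simp add: \<phi>_def lookup_add single_add sum.distrib)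
qed

text \<open>By cancellation \<open>k' = k\<close> forces \<open>l' = l\<close>, so a single product
  contributes to this coefficient. The case of interest is a sum of extreme exponents.\<close>

lemma lookup_times_unique:
  fixes p q :: "('a \<Rightarrow>\<^sub>0 nat) \<Rightarrow>\<^sub>0 'k::comm_ring_1"
  assumes "k \<in> Poly_Mapping.keys p"
    and "\<And>k' l'. k' \<in> Poly_Mapping.keys p \<Longrightarrow> l' \<in> Poly_Mapping.keys q \<Longrightarrow> k' + l' = k + l \<Longrightarrow> k' = k"
  shows "Poly_Mapping.lookup (p * q) (k + l) = Poly_Mapping.lookup p k * Poly_Mapping.lookup q l"
proof -
  have "Poly_Mapping.lookup (p * q) (k + l) =
      (\<Sum>k'\<in>Poly_Mapping.keys p. Poly_Mapping.lookup (Poly_Mapping.single k' (Poly_Mapping.lookup p k') * q) (k + l))"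
    by (subst (1) poly_mapping_sum_singles[of p, symmetric]) (simp add: sum_distrib_right lookup_sum)
  also have "\<dots> = (\<Sum>k'\<in>Poly_Mapping.keys p. if k' = k then Poly_Mapping.lookup p k * Poly_Mapping.lookup q l else 0)"
  proof (intro sum.cong refl)
    fix k' assume k': "k' \<in> Poly_Mapping.keys p"
    show "Poly_Mapping.lookup (Poly_Mapping.single k' (Poly_Mapping.lookup p k') * q) (k + l) =
        (if k' = k then Poly_Mapping.lookup p k * Poly_Mapping.lookup q l else 0)"
    proof (cases "k' = k")
      case False
      \<comment> \<open>The only candidate partner of \<open>k'\<close> is
        \<open>k + l - k'\<close>; were it in the support of \<open>q\<close>, then
        \<open>k' = k\<close>.\<close>
      with assms(2)[OF k', of "k + l - k'"] show ?thesis
        by (cases "Poly_Mapping.lookup q (k + l - k') = 0") (auto simp: lookup_single_times in_keys_iff exp_le_add_diff)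
    qed (simp add: lookup_single_times_add)
  qed
  finally show ?thesis
    using assms(1) by simp
qed

text \<open>The largest exponents of \<open>p\<close> and \<open>q\<close> add up to an exponent of
  the product, and so do the smallest. Both sums are \<open>t\<close>, hence the extremes of
  \<open>p\<close> coincide.\<close>

lemma dvd_single_imp_single:
  fixes p :: "('a::finite \<Rightarrow>\<^sub>0 nat) \<Rightarrow>\<^sub>0 'k::field"
  assumes "p dvd mon t"
  obtains s c where "c \<noteq> 0" "p = Poly_Mapping.single s c"
proof -
  from assms obtain q where pq: "mon t = p * q" ..
  obtain e :: "'a \<Rightarrow> nat" where "inj e"
    using finite_imp_inj_to_nat_seg[of "UNIV :: 'a set"] by auto
  define \<phi> where "\<phi> = (\<lambda>t :: 'a \<Rightarrow>\<^sub>0 nat. \<Sum>v\<in>UNIV. Poly_Mapping.single (e v) (Poly_Mapping.lookup t v))"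
  have inj: "inj \<phi>" and add: "\<phi> (s + t) = \<phi> s + \<phi> t" for s t
    unfolding \<phi>_def by (rule inj_exponent_transfer[OF \<open>inj e\<close>])+
  have "p * q \<noteq> 0"
    by (metis lookup_single_eq lookup_zero pq zero_neq_one)
  then have "p \<noteq> 0" "q \<noteq> 0"
    by auto
  then have ne: "Poly_Mapping.keys p \<noteq> {}" "Poly_Mapping.keys q \<noteq> {}"
    by auto
  have t_eq: "k + l = t" if "k \<in> Poly_Mapping.keys p" "l \<in> Poly_Mapping.keys q"
    "\<And>k' l'. k' \<in> Poly_Mapping.keys p \<Longrightarrow> l' \<in> Poly_Mapping.keys q \<Longrightarrow> k' + l' = k + l \<Longrightarrow> k' = k" for k l
  proof -
    have "Poly_Mapping.lookup (mon t) (k + l) = Poly_Mapping.lookup p k * Poly_Mapping.lookup q l"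
      unfolding pq using that by (intro lookup_times_unique)
    with that show ?thesis
      by (auto simp: in_keys_iff lookup_single when_def split: if_splits)
  qed
  let ?P = "\<phi> ` Poly_Mapping.keys p" and ?Q = "\<phi> ` Poly_Mapping.keys q"
  have fin: "finite ?P" "finite ?Q" "?P \<noteq> {}" "?Q \<noteq> {}"
    using ne by auto
  obtain k l where kl: "k \<in> Poly_Mapping.keys p" "\<phi> k = Max ?P" "l \<in> Poly_Mapping.keys q" "\<phi> l = Max ?Q"
    using Max_in[OF fin(1,3)] Max_in[OF fin(2,4)] by auto
  obtain k0 l0 where kl0: "k0 \<in> Poly_Mapping.keys p" "\<phi> k0 = Min ?P" "l0 \<in> Poly_Mapping.keys q" "\<phi> l0 = Min ?Q"
    using Min_in[OF fin(1,3)] Min_in[OF fin(2,4)] by auto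
  have max: "\<phi> k' \<le> \<phi> k" "\<phi> k0 \<le> \<phi> k'" if "k' \<in> Poly_Mapping.keys p" for k'
    using that kl kl0 fin by auto
  have max': "\<phi> l' \<le> \<phi> l" "\<phi> l0 \<le> \<phi> l'" if "l' \<in> Poly_Mapping.keys q" for l'
    using that kl kl0 fin by auto
  \<comment> \<open>Equal sums with termwise inequalities have equal terms, by strict monotonicity
    of addition.\<close>
  have eq1: "\<phi> k' = \<phi> k1" if "\<phi> k' + \<phi> l' = \<phi> k1 + \<phi> l1" "\<phi> k' \<le> \<phi> k1" "\<phi> l' \<le> \<phi> l1" for k' l' k1 l1
  proof (rule ccontr)
    assume "\<phi> k' \<noteq> \<phi> k1"
    then have "\<phi> k' + \<phi> l' < \<phi> k1 + \<phi> l1"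
      using that by (intro add_less_le_mono) simp_all
    with that(1) show False by simp
  qed
  have "k + l = t"
  proof (rule t_eq[OF kl(1,3)])
    fix k' l' assume "k' \<in> Poly_Mapping.keys p" "l' \<in> Poly_Mapping.keys q" "k' + l' = k + l"
    then have "\<phi> k' = \<phi> k"
      by (intro eq1[of k' l' k l] max max') (simp_all flip: add)
    then show "k' = k" by (rule injD[OF inj])
  qed
  moreover have "k0 + l0 = t"
  proof (rule t_eq[OF kl0(1,3)])
    fix k' l' assume "k' \<in> Poly_Mapping.keys p" "l' \<in> Poly_Mapping.keys q" "k' + l' = k0 + l0"
    \<comment> \<open>At the minimum the inequalities are reversed, so the two pairs change places
      in \<open>eq1\<close>.\<close>
    then have "\<phi> k0 = \<phi> k'"
      by (intro eq1[of k0 l0 k' l'] max max') (simp_all flip: add)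
    then show "k' = k0" using injD[OF inj] by metis
  qed
  ultimately have "\<phi> k0 + \<phi> l0 = \<phi> k + \<phi> l"
    by (metis add)
  then have eq: "\<phi> k0 = \<phi> k"
    by (rule eq1) (rule max(1)[OF kl0(1)], rule max'(1)[OF kl0(3)])
  have uniq: "k' = k" if "k' \<in> Poly_Mapping.keys p" for k'
    using max[OF that] unfolding eq by (intro injD[OF inj] antisym)
  have "p = Poly_Mapping.single k (Poly_Mapping.lookup p k)"
  proof (rule poly_mapping_eqI)
    fix x
    show "Poly_Mapping.lookup p x = Poly_Mapping.lookup (Poly_Mapping.single k (Poly_Mapping.lookup p k)) x"
      using uniq[of x] by (cases "x = k") (auto simp: in_keys_iff lookup_single_not_eq)
  qed
  moreover have "Poly_Mapping.lookup p k \<noteq> 0"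
    using kl(1) by (simp add: in_keys_iff)
  ultimately show ?thesis
    by (rule that[rotated])
qed

text \<open>Every common divisor is a scalar multiple of a monomial, so only exponents need to be
  compared.\<close>

lemma is_gcd_single:
  fixes a b c :: "'a::finite \<Rightarrow>\<^sub>0 nat"
  assumes "\<And>v. Poly_Mapping.lookup c v = min (Poly_Mapping.lookup a v) (Poly_Mapping.lookup b v)"
  shows "is_gcd (mon c :: ('a \<Rightarrow>\<^sub>0 nat) \<Rightarrow>\<^sub>0 'k::field) (mon a) (mon b)"
  unfolding is_gcd_def
proof (intro conjI allI impI)
  fix e :: "('a \<Rightarrow>\<^sub>0 nat) \<Rightarrow>\<^sub>0 'k"
  assume e: "e dvd mon a \<and> e dvd mon b"
  then obtain s x where "x \<noteq> 0" "e = Poly_Mapping.single s x"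
    by (meson dvd_single_imp_single)
  with e assms show "e dvd mon c"
    by (simp add: single_dvd_single_iff exp_le_def)
qed (use assms in \<open>simp_all add: single_dvd_single_iff exp_le_def\<close>)

lemma is_gcd_umono:
  "is_gcd (umono (A \<inter> B)) (umono A) (umono B :: ('i::finite, 'j::finite, 'k::field) bipoly)"
  unfolding umono_eq_single
proof (rule is_gcd_single)
  show "Poly_Mapping.lookup (squarefree_exp (A \<inter> B) :: ('i + 'j) \<Rightarrow>\<^sub>0 nat) v =
      min (Poly_Mapping.lookup (squarefree_exp A) v) (Poly_Mapping.lookup (squarefree_exp B) v)" for v
    by (cases v) (auto simp: lookup_squarefree_exp)
qed

section \<open>Simplicial Nagata polynomials\<close>

definition nagata_exp :: "nat \<Rightarrow> ('i \<Rightarrow> 'j set) \<Rightarrow> 'i \<Rightarrow> ('i + 'j) \<Rightarrow>\<^sub>0 nat" where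
  "nagata_exp d G r = Poly_Mapping.single (Inl r) d + squarefree_exp (G r)"

lemma lookup_nagata_exp:
  fixes G :: "'i \<Rightarrow> 'j::finite set"
  shows "Poly_Mapping.lookup (nagata_exp d G r) (Inl i) = (if i = r then d else 0)"
    and "Poly_Mapping.lookup (nagata_exp d G r) (Inr j) = (if j \<in> G r then 1 else 0)"
  by (simp_all add: nagata_exp_def lookup_add lookup_single lookup_squarefree_exp)

lemma nagata_exp_split:
  fixes G :: "'i \<Rightarrow> 'j::finite set"
  assumes "C \<subseteq> G p"
  shows "nagata_exp d G p = Poly_Mapping.single (Inl p) d + squarefree_exp C + squarefree_exp (G p - C)"
  unfolding nagata_exp_def squarefree_exp_subset[OF assms] by (simp add: add.assoc)

text \<open>The x-part alone separates the exponents, because \<open>d\<close> is positive.\<close>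

lemma inj_nagata_exp: "1 \<le> d \<Longrightarrow> inj (nagata_exp d G)" for G :: "'i \<Rightarrow> 'j::finite set"
proof (rule injI)
  fix r q assume "1 \<le> d" "nagata_exp d G r = nagata_exp d G q"
  then have "Poly_Mapping.lookup (nagata_exp d G r) (Inl q) = d"
    by (simp add: lookup_nagata_exp)
  with \<open>1 \<le> d\<close> show "r = q"
    by (simp add: lookup_nagata_exp split: if_splits)
qed

text \<open>The square-free part contributes only the factors \<open>0!\<close> and
  \<open>1!\<close>, so the value does not depend on \<open>r\<close>.\<close>

lemma fact_exp_nagata_exp:
  fixes G :: "'i::finite \<Rightarrow> 'j::finite set"
  shows "fact_exp (nagata_exp d G r) = (fact d :: 'k::field_char_0)"
proof -
  have "fact (Poly_Mapping.lookup (nagata_exp d G r) v) = (if v = Inl r then fact d else 1 :: 'k)" for v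
    by (cases v) (auto simp: lookup_nagata_exp)
  then show ?thesis
    by (simp add: fact_exp_def)
qed

lemma mon_in_subspace:
  assumes "module.subspace (*) I" "mon s \<in> I" "exp_le s t"
  shows "(mon t :: ('a \<Rightarrow>\<^sub>0 nat) \<Rightarrow>\<^sub>0 'k::comm_ring_1) \<in> I"
proof -
  have "(mon t :: ('a \<Rightarrow>\<^sub>0 nat) \<Rightarrow>\<^sub>0 'k) = mon (t - s) * mon s"
    using exp_le_add_diff[OF assms(3)] by (simp add: mult_single add.commute)
  then show ?thesis
    using module.subspace_scale[OF module_times assms(1,2)] by simp
qed

lemma exp_le_nagata_exp_iff:
  fixes G :: "'i \<Rightarrow> 'j::finite set"
  shows "exp_le (squarefree_exp A) (nagata_exp d G r) \<longleftrightarrow> A \<subseteq> G r"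
    and "exp_le (squarefree_exp A) (squarefree_exp B :: ('i + 'j) \<Rightarrow>\<^sub>0 nat) \<longleftrightarrow> A \<subseteq> B"
  by (auto simp: exp_le_def split_sum_all lookup_nagata_exp lookup_squarefree_exp lookup_add lookup_single when_def)

text \<open>Each of the two monomials contributes 1 to the condition at its complementary exponent
  and 0 elsewhere. The complements agree, so the contributions cancel.\<close>

lemma apolar_binomial:
  fixes G :: "'i::finite \<Rightarrow> 'j::finite set"
  assumes d: "1 \<le> d" and AB: "A \<subseteq> G r" "B \<subseteq> G s" "G r - A = G s - B"
  shows "apolar (nagata_exp d G) (xvar r ^ d * umono A - xvar s ^ d * umono B :: ('i, 'j, 'k::comm_ring_1) bipoly)"
  unfolding apolar_def
proof
  fix w :: "('i + 'j) \<Rightarrow>\<^sub>0 nat"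
  let ?m = "nagata_exp d G"
  have count: "(\<Sum>q | exp_le w (?m q). Poly_Mapping.lookup (xvar p ^ d * umono C :: ('i, 'j, 'k) bipoly) (?m q - w)) =
      (if w = squarefree_exp (G p - C) then 1 else 0)" if "C \<subseteq> G p" for p C
  proof -
    have eqv: "Poly_Mapping.single (Inl p) d + squarefree_exp C = ?m q - w \<and> exp_le w (?m q) \<longleftrightarrow>
        q = p \<and> w = squarefree_exp (G p - C)" for q
    proof -
      have "Poly_Mapping.single (Inl p) d + squarefree_exp C = ?m q - w \<and> exp_le w (?m q) \<longleftrightarrow>
          Poly_Mapping.single (Inl p) d + squarefree_exp C + w = ?m q"
        by (rule add_eq_exp_iff[symmetric])
      also have "\<dots> \<longleftrightarrow> q = p \<and> w = squarefree_exp (G p - C)"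
      proof
        assume eq: "Poly_Mapping.single (Inl p) d + squarefree_exp C + w = ?m q"
        \<comment> \<open>On the left \<open>x\<^sub>p\<close> has exponent at least
          \<open>d > 0\<close>; on the right its exponent is 0 unless \<open>q = p\<close>.\<close>
        from arg_cong[OF eq, of "\<lambda>u. Poly_Mapping.lookup u (Inl p)"] d have "q = p"
          by (auto simp: lookup_nagata_exp lookup_add split: if_splits)
        with eq nagata_exp_split[of C G p d, OF that] show "q = p \<and> w = squarefree_exp (G p - C)"
          by (metis add_left_cancel)
      qed (use nagata_exp_split[of C G p d, OF that] in simp)
      finally show ?thesis .
    qed
    have "Poly_Mapping.lookup (xvar p ^ d * umono C :: ('i, 'j, 'k) bipoly) (?m q - w) =
        (if q = p then if w = squarefree_exp (G p - C) then 1 else 0 else 0)" if "exp_le w (?m q)" for q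
      unfolding xvar_power_eq_single umono_eq_single mult_single lookup_single when_def
      using eqv[of q] that by auto
    then have "(\<Sum>q | exp_le w (?m q). Poly_Mapping.lookup (xvar p ^ d * umono C :: ('i, 'j, 'k) bipoly) (?m q - w)) =
        (\<Sum>q | exp_le w (?m q). if q = p then if w = squarefree_exp (G p - C) then 1 else 0 else 0)"
      by (intro sum.cong refl) blast
    moreover have "exp_le w (?m p)" if "w = squarefree_exp (G p - C)"
      \<comment> \<open>This puts \<open>p\<close> in the index set of the sum, so the 1 is really
        counted.\<close>
      using that by (simp add: exp_le_nagata_exp_iff)
    ultimately show ?thesis
      by (simp add: sum.delta)
  qed
  show "(\<Sum>q | exp_le w (?m q). Poly_Mapping.lookup (xvar r ^ d * umono A - xvar s ^ d * umono B :: ('i, 'j, 'k) bipoly) (?m q - w)) = 0"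
    by (simp add: lookup_minus sum_subtractf count AB)
qed

lemma minimal_nonface_exists:
  assumes "finite A" "A \<noteq> {}" "A \<notin> complex_faces g"
  shows "\<exists>B\<subseteq>A. minimal_nonface g B"
  using assms
proof (induction A rule: finite_psubset_induct)
  case (psubset A)
  show ?case
  proof (cases "minimal_nonface g A")
    case False
    then obtain B where B: "B \<noteq> {}" "B \<subset> A" "B \<notin> complex_faces g"
      using psubset.prems unfolding minimal_nonface_def by blast
    from psubset.IH[OF B(2,1,3)] B(2) show ?thesis
      by blast
  qed blast
qed

lemma uvar_dvd_umono_iff:
  "(uvar j :: ('i, 'j::finite, 'k::field) bipoly) dvd umono A \<longleftrightarrow> j \<in> A"
  by (auto simp: uvar_def umono_eq_single single_dvd_single_iff exp_le_def split_sum_all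
      lookup_squarefree_exp lookup_single when_def)

text \<open>A gcd is determined only up to a unit; the factorization pins it down to a square-free
  monomial with coefficient 1.\<close>

lemma umono_times_eq_imp:
  fixes h :: "('i, 'j::finite, 'k::field) bipoly"
  assumes "umono B = umono A * h"
  shows "A \<subseteq> B" and "h = umono (B - A)"
proof -
  note h = mon_times_eq_imp[OF assms[unfolded umono_eq_single]]
  from h(1) show AB: "A \<subseteq> B"
    by (simp add: exp_le_nagata_exp_iff)
  have "squarefree_exp B - squarefree_exp A = (squarefree_exp (B - A) :: ('i + 'j) \<Rightarrow>\<^sub>0 nat)"
    unfolding squarefree_exp_subset[OF AB] by simp
  with h(2) show "h = umono (B - A)"
    by (simp add: umono_eq_single)
qed

lemma umono_Un_disjoint: "A \<inter> B = {} \<Longrightarrow> umono (A \<union> B) = umono A * umono B"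
  for A B :: "'j::finite set"
  by (simp add: umono_def prod.union_disjoint)

lemma umono_eq_iff: "umono A = (umono B :: ('i, 'j::finite, 'k::field) bipoly) \<longleftrightarrow> A = B"
  by (metis uvar_dvd_umono_iff set_eqI)

section \<open>The generators and the ideal they span\<close>

text \<open>The index type is unordered, so \<open>i \<noteq> j\<close> replaces
  \<open>i < j\<close>, which gives the same products.\<close>

definition nagata_generators ::
    "nat \<Rightarrow> nat \<Rightarrow> ('i::finite \<Rightarrow> ('i, 'j::finite, 'k::field) bipoly) \<Rightarrow> ('i, 'j, 'k) bipoly set" where
  "nagata_generators d1 d2 g =
    {xvar i * xvar j | i j. i \<noteq> j} \<union> {xvar k ^ (d1 + 1) | k. True}
    \<union> {uvar i ^ 2 | i. True}
    \<union> {umono A | A. minimal_nonface g A \<and> card A \<in> {1..d2 + 1}}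
    \<union> {xvar r * uvar i | r i. \<not> uvar i dvd g r}
    \<union> {xvar r ^ d1 * umono A - xvar s ^ d1 * umono B | r s A B.
         card A = card B \<and>
         (\<exists>h. is_gcd h (g r) (g s) \<and> g r = umono A * h \<and> g s = umono B * h)}"

lemma nagata_generatorsI:
  shows "i \<noteq> j \<Longrightarrow> xvar i * xvar j \<in> nagata_generators d1 d2 g"
    and "xvar k ^ (d1 + 1) \<in> nagata_generators d1 d2 g"
    and "uvar l ^ 2 \<in> nagata_generators d1 d2 g"
    and "minimal_nonface g A \<Longrightarrow> card A \<in> {1..d2 + 1} \<Longrightarrow> umono A \<in> nagata_generators d1 d2 g"
    and "\<not> uvar l dvd g r \<Longrightarrow> xvar r * uvar l \<in> nagata_generators d1 d2 g"
    and "card A = card B \<Longrightarrow> is_gcd h (g r) (g s) \<Longrightarrow> g r = umono A * h \<Longrightarrow> g s = umono B * h \<Longrightarrow>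
      xvar r ^ d1 * umono A - xvar s ^ d1 * umono B \<in> nagata_generators d1 d2 g"
  unfolding nagata_generators_def by blast+

lemma complex_faces_umono:
  fixes G :: "'i \<Rightarrow> 'j::finite set"
  shows "complex_faces (\<lambda>r. umono (G r) :: ('i, 'j, 'k::field) bipoly) = {A. A \<noteq> {} \<and> (\<exists>r. A \<subseteq> G r)}"
  by (simp add: complex_faces_def usupp_def uvar_dvd_umono_iff)

text \<open>Removing one vertex leaves a face or the empty set, hence at most \<open>d\<close>
  vertices.\<close>

lemma card_minimal_nonface:
  fixes g :: "'i \<Rightarrow> ('i, 'j::finite, 'k::comm_ring_1) bipoly"
  assumes "minimal_nonface g A" "\<And>r. card (usupp (g r)) \<le> d"
  shows "card A \<in> {1..d + 1}"
proof -
  have A: "A \<noteq> {}" "\<And>B. B \<noteq> {} \<Longrightarrow> B \<subset> A \<Longrightarrow> B \<in> complex_faces g"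
    using assms(1) by (simp_all add: minimal_nonface_def)
  from A(1) obtain a where a: "a \<in> A" by blast
  have "card (A - {a}) \<le> d"
  proof (cases "A - {a} = {}")
    case False
    moreover have "A - {a} \<subset> A"
      using a by blast
    ultimately have "A - {a} \<in> complex_faces g"
      by (rule A(2))
    then obtain r where "A - {a} \<subseteq> usupp (g r)"
      by (auto simp: complex_faces_def)
    then have "card (A - {a}) \<le> card (usupp (g r))"
      by (intro card_mono) simp_all
    with assms(2)[of r] show ?thesis by linarith
  qed (simp only: card.empty le0)
  moreover have "card A = Suc (card (A - {a}))"
    using a by (intro card.remove) simp_all
  ultimately show ?thesis by simp
qed

text \<open>In each monomial family some variable exceeds its exponent in every
  \<open>m\<^sub>r\<close>; the binomials are covered by \<open>apolar_binomial\<close>.\<close>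

lemma nagata_generators_apolar:
  fixes G :: "'i::finite \<Rightarrow> 'j::finite set"
  assumes d: "1 \<le> d1"
  defines "g \<equiv> \<lambda>r. umono (G r) :: ('i, 'j, 'k::field) bipoly"
  assumes p: "p \<in> nagata_generators d1 d2 g"
  shows "apolar (nagata_exp d1 G) p"
proof -
  let ?m = "nagata_exp d1 G"
  have not_le: "\<not> exp_le t (?m r)" if "Poly_Mapping.lookup t v > Poly_Mapping.lookup (?m r) v" for t r v
    using that by (auto simp: exp_le_def not_le)
  from p consider
      (xx) i j where "i \<noteq> j" "p = xvar i * xvar j"
    | (xd) k where "p = xvar k ^ (d1 + 1)"
    | (uu) l where "p = uvar l ^ 2"
    | (nonface) A where "minimal_nonface g A" "p = umono A"
    | (xu) r l where "\<not> uvar l dvd g r" "p = xvar r * uvar l"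
    | (bino) r s A B h where "p = xvar r ^ d1 * umono A - xvar s ^ d1 * umono B"
        "g r = umono A * h" "g s = umono B * h"
    unfolding nagata_generators_def Un_iff mem_Collect_eq by (elim disjE exE conjE; metis)
  then show ?thesis
  proof cases
    case xx
    have "\<not> exp_le (Poly_Mapping.single (Inl i) 1 + Poly_Mapping.single (Inl j) 1) (?m r)" for r
      \<comment> \<open>Only \<open>x\<^sub>r\<close> occurs in \<open>?m r\<close>, so
        \<open>x\<^sub>j\<close> is the obstruction if \<open>i = r\<close>, and
        \<open>x\<^sub>i\<close> otherwise.\<close>
      using xx(1) not_le[where v = "Inl i"] not_le[where v = "Inl j"]
      by (cases "i = r") (simp_all add: lookup_nagata_exp lookup_add lookup_single)
    then show ?thesis
      unfolding xx(2) xvar_times_eq_single by (rule apolar_single)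
  next
    case xd
    have "\<not> exp_le (Poly_Mapping.single (Inl k) (d1 + 1)) (?m r)" for r
      by (rule not_le[where v = "Inl k"]) (simp add: lookup_nagata_exp)
    then show ?thesis
      unfolding xd xvar_power_eq_single by (rule apolar_single)
  next
    case uu
    have "\<not> exp_le (Poly_Mapping.single (Inr l) 2) (?m r)" for r
      by (rule not_le[where v = "Inr l"]) (simp add: lookup_nagata_exp)
    then show ?thesis
      unfolding uu uvar_power_eq_single by (rule apolar_single)
  next
    case nonface
    then have "\<not> A \<subseteq> G r" for r
      unfolding minimal_nonface_def g_def complex_faces_umono by blast
    then show ?thesis
      unfolding nonface(2) umono_eq_single by (intro apolar_single) (simp add: exp_le_nagata_exp_iff)
  next
    case xu
    then have l: "l \<notin> G r"
      by (simp add: g_def uvar_dvd_umono_iff)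
    have "\<not> exp_le (Poly_Mapping.single (Inl r) 1 + Poly_Mapping.single (Inr l) 1) (?m q)" for q
      using l not_le[where v = "Inl r"] not_le[where v = "Inr l"]
      by (cases "q = r") (simp_all add: lookup_nagata_exp lookup_add lookup_single)
    then show ?thesis
      unfolding xu(2) xvar_times_eq_single by (rule apolar_single)
  next
    case bino
    note A = umono_times_eq_imp[OF bino(2)[unfolded g_def]] and B = umono_times_eq_imp[OF bino(3)[unfolded g_def]]
    \<comment> \<open>Both sides equal \<open>h\<close>.\<close>
    have "umono (G r - A) = (umono (G s - B) :: ('i, 'j, 'k) bipoly)"
      using A(2) B(2) by simp
    then show ?thesis
      unfolding bino(1) umono_eq_iff by (intro apolar_binomial d A(1) B(1))
  qed
qed

text \<open>Unless \<open>t\<close> is divisible by a generator of type 1, 2 or 4, it either divides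
  some \<open>m\<^sub>r\<close> or is a square-free monomial in the \<open>U\<^sub>j\<close> alone,
  whose support must then be a nonface.\<close>

lemma apolar_monomial_in_ideal:
  fixes G :: "'i::finite \<Rightarrow> 'j::finite set" and t :: "('i + 'j) \<Rightarrow>\<^sub>0 nat"
  defines "g \<equiv> \<lambda>r. umono (G r) :: ('i, 'j, 'k::field) bipoly"
  assumes I: "module.subspace (*) I" "nagata_generators d1 d2 g \<subseteq> I"
    and card: "\<And>r. card (G r) = d2"
    and t: "\<And>r. \<not> exp_le t (nagata_exp d1 G r)"
  shows "mon t \<in> I"
proof -
  note gen = subsetD[OF I(2) nagata_generatorsI(1)] subsetD[OF I(2) nagata_generatorsI(2)]
    subsetD[OF I(2) nagata_generatorsI(3)] subsetD[OF I(2) nagata_generatorsI(4)]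
    subsetD[OF I(2) nagata_generatorsI(5)]
  define A where "A = {j. Poly_Mapping.lookup t (Inr j) > 0}"
  consider
      (xx) i j where "i \<noteq> j" "Poly_Mapping.lookup t (Inl i) > 0" "Poly_Mapping.lookup t (Inl j) > 0"
    | (xd) k where "Poly_Mapping.lookup t (Inl k) > d1"
    | (uu) l where "Poly_Mapping.lookup t (Inr l) > 1"
    | (xu) r l where "Poly_Mapping.lookup t (Inl r) > 0" "l \<in> A" "l \<notin> G r"
    | (x) r where "\<And>i. i \<noteq> r \<Longrightarrow> Poly_Mapping.lookup t (Inl i) = 0" "Poly_Mapping.lookup t (Inl r) \<le> d1"
        "\<And>l. Poly_Mapping.lookup t (Inr l) \<le> 1" "A \<subseteq> G r"
    | (u) "\<And>i. Poly_Mapping.lookup t (Inl i) = 0" "\<And>l. Poly_Mapping.lookup t (Inr l) \<le> 1"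
    by (metis linorder_not_less gr0I subsetI)
  then show ?thesis
  proof cases
    case xx
    have "mon (Poly_Mapping.single (Inl i) 1 + Poly_Mapping.single (Inl j) 1) \<in> I"
      using gen(1)[OF xx(1)] unfolding xvar_times_eq_single .
    then show ?thesis
      by (rule mon_in_subspace[OF I(1)])
        (use xx in \<open>auto simp: exp_le_def lookup_add lookup_single when_def\<close>)
  next
    case xd
    have "mon (Poly_Mapping.single (Inl k) (d1 + 1)) \<in> I"
      using gen(2) unfolding xvar_power_eq_single .
    then show ?thesis
      by (rule mon_in_subspace[OF I(1)])
        (use xd in \<open>auto simp: exp_le_def lookup_single when_def\<close>)
  next
    case uu
    have "mon (Poly_Mapping.single (Inr l) 2) \<in> I"
      using gen(3) unfolding uvar_power_eq_single .
    then show ?thesis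
      by (rule mon_in_subspace[OF I(1)])
        (use uu in \<open>auto simp: exp_le_def lookup_single when_def\<close>)
  next
    case xu
    then have "\<not> uvar l dvd g r"
      by (simp add: g_def uvar_dvd_umono_iff)
    from gen(5)[OF this] have "mon (Poly_Mapping.single (Inl r) 1 + Poly_Mapping.single (Inr l) 1) \<in> I"
      unfolding xvar_times_eq_single .
    then show ?thesis
      by (rule mon_in_subspace[OF I(1)])
        (use xu in \<open>auto simp: A_def exp_le_def lookup_add lookup_single when_def\<close>)
  next
    case x
    then have "exp_le t (nagata_exp d1 G r)"
      by (auto simp: exp_le_def split_sum_all lookup_nagata_exp A_def)
    with t show ?thesis by blast
  next
    case u
    have "\<not> A \<subseteq> G r" for r
    proof
      assume "A \<subseteq> G r"
      then have "Poly_Mapping.lookup t (Inr l) \<le> (if l \<in> G r then 1 else 0)" for l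
        using u(2)[of l] by (auto simp: A_def)
      with u(1) t[of r] show False
        by (simp add: exp_le_def split_sum_all lookup_nagata_exp)
    qed
    then have "A \<noteq> {}" "A \<notin> complex_faces g"
      unfolding g_def complex_faces_umono by auto
    \<comment> \<open>A minimal nonface inside the support gives a generator dividing
      \<open>mon t\<close>.\<close>
    then obtain B where B: "B \<subseteq> A" "minimal_nonface g B"
      using minimal_nonface_exists[of A g] by auto
    have "card B \<in> {1..d2 + 1}"
      by (rule card_minimal_nonface[OF B(2)]) (simp add: g_def usupp_def uvar_dvd_umono_iff card)
    with B(2) have "mon (squarefree_exp B) \<in> I"
      using gen(4) by (simp add: umono_eq_single)
    then show ?thesis
      by (rule mon_in_subspace[OF I(1)])
        (use B(1) in \<open>auto simp: exp_le_def split_sum_all lookup_squarefree_exp A_def\<close>)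
  qed
qed

text \<open>A common divisor of two exponents is supported on some \<open>C\<close> inside the
  common face \<open>H\<close>. The difference is then the binomial generator of the two facets
  times \<open>umono (H - C)\<close>.\<close>

lemma apolar_pair_in_ideal:
  fixes G :: "'i::finite \<Rightarrow> 'j::finite set" and s :: "('i + 'j) \<Rightarrow>\<^sub>0 nat"
  defines "g \<equiv> \<lambda>r. umono (G r) :: ('i, 'j, 'k::field) bipoly"
  assumes I: "module.subspace (*) I" "nagata_generators d1 d2 g \<subseteq> I"
    and card: "\<And>r. card (G r) = d2"
    and rq: "r \<noteq> q" "exp_le s (nagata_exp d1 G r)" "exp_le s (nagata_exp d1 G q)"
  shows "mon (nagata_exp d1 G r - s) - mon (nagata_exp d1 G q - s) \<in> I"
proof -
  define C where "C = {j. Poly_Mapping.lookup s (Inr j) > 0}"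
  define H where "H = G r \<inter> G q"
  have le: "Poly_Mapping.lookup s v \<le> Poly_Mapping.lookup (nagata_exp d1 G r) v"
    "Poly_Mapping.lookup s v \<le> Poly_Mapping.lookup (nagata_exp d1 G q) v" for v
    using rq by (auto simp: exp_le_def)
  \<comment> \<open>Since \<open>r \<noteq> q\<close>, each x-variable is absent from at least one
    of the two monomials.\<close>
  have "Poly_Mapping.lookup s (Inl i) = 0" for i
    using le[of "Inl i"] rq(1) by (auto simp: lookup_nagata_exp split: if_splits)
  moreover have "Poly_Mapping.lookup s (Inr j) = (if j \<in> C then 1 else 0)" for j
    using le(1)[of "Inr j"] by (auto simp: lookup_nagata_exp C_def split: if_splits)
  ultimately have s: "s = squarefree_exp C"
    by (intro poly_mapping_eqI) (metis sum.exhaust lookup_squarefree_exp)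
  have CH: "C \<subseteq> H"
    using rq(2,3) by (simp add: s exp_le_nagata_exp_iff H_def)
  have mon: "mon (nagata_exp d1 G p - s) = umono (H - C) * (xvar p ^ d1 * umono (G p - H) :: ('i, 'j, 'k) bipoly)"
    if "H \<subseteq> G p" for p
  proof -
    have "nagata_exp d1 G p - s = Poly_Mapping.single (Inl p) d1 + squarefree_exp (G p - C)"
      using nagata_exp_split[of C G p d1] CH that unfolding s
      by (metis (no_types, lifting) add.commute add.left_commute add_diff_cancel_left' order_trans)
    moreover have "G p - C = (H - C) \<union> (G p - H)"
      using CH that by auto
    then have "umono (G p - C) = umono (H - C) * (umono (G p - H) :: ('i, 'j, 'k) bipoly)"
      by (simp only:) (rule umono_Un_disjoint, blast)
    moreover have "mon (Poly_Mapping.single (Inl p) d1 + squarefree_exp (G p - C)) =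
        xvar p ^ d1 * (umono (G p - C) :: ('i, 'j, 'k) bipoly)"
      by (simp add: xvar_power_eq_single umono_eq_single mult_single)
    ultimately show ?thesis
      by (simp only: mult.left_commute)
  qed
  have "xvar r ^ d1 * umono (G r - H) - xvar q ^ d1 * umono (G q - H) \<in> nagata_generators d1 d2 g"
  proof (rule nagata_generatorsI(6))
    \<comment> \<open>The two differences have equal size because all facets have \<open>d2\<close>
      vertices.\<close>
    have "card (G p - H) = d2 - card H" if "H \<subseteq> G p" for p
      using that card by (simp add: card_Diff_subset)
    then show "card (G r - H) = card (G q - H)"
      by (simp add: H_def)
    show "is_gcd (umono H) (g r) (g q)"
      unfolding g_def H_def by (rule is_gcd_umono)
    have "g p = umono (G p - H) * umono H" if "H \<subseteq> G p" for p
      unfolding g_def using that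
      by (subst umono_Un_disjoint[symmetric]) (auto simp: Un_absorb2)
    then show "g r = umono (G r - H) * umono H" "g q = umono (G q - H) * umono H"
      by (auto simp: H_def)
  qed
  with I have "umono (H - C) * (xvar r ^ d1 * umono (G r - H) - xvar q ^ d1 * umono (G q - H)) \<in> I"
    using module.subspace_scale[OF module_times I(1)] by blast
  then show ?thesis
    by (simp add: mon H_def right_diff_distrib)
qed

theorem corollary3p19:
  fixes g :: "'i::finite \<Rightarrow> ('i, 'j::finite, 'k::field_char_0) bipoly"
    and f :: "('i, 'j, 'k) bipoly"
    and d1 d2 :: nat
  assumes "simplicial_nagata d1 d2 g f"
  shows "Ann f = ideal_gen
    ( {xvar i * xvar j | i j. i \<noteq> j} \<union> {xvar k ^ (d1 + 1) | k. True}
    \<union> {uvar i ^ 2 | i. True}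
    \<union> {umono A | A. minimal_nonface g A \<and> card A \<in> {1..d2 + 1}}
    \<union> {xvar r * uvar i | r i. \<not> uvar i dvd g r}
    \<union> {xvar r ^ d1 * umono A - xvar s ^ d1 * umono B | r s A B.
         card A = card B \<and>
         (\<exists>h. is_gcd h (g r) (g s) \<and> g r = umono A * h \<and> g s = umono B * h)})"
proof -
  from assms have d1: "1 \<le> d1" and "\<forall>r. \<exists>A. card A = d2 \<and> g r = umono A"
    and f: "f = (\<Sum>r\<in>UNIV. xvar r ^ d1 * g r)"
    unfolding simplicial_nagata_def by blast+
  then obtain G where card: "\<And>r. card (G r) = d2" and "\<And>r. g r = umono (G r)"
    by metis
  then have g: "g = (\<lambda>r. umono (G r))" by blast
  define I where "I = ideal_gen (nagata_generators d1 d2 g)"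
  have I: "module.subspace (*) I" "nagata_generators d1 d2 g \<subseteq> I"
    unfolding I_def ideal_gen_def
    by (rule module.subspace_span[OF module_times], rule module.span_superset[OF module_times])
  have I_sub: "I \<subseteq> Collect (apolar (nagata_exp d1 G))"
    unfolding I_def ideal_gen_def
    by (intro module.span_minimal[OF module_times] subspace_apolar)
      (use nagata_generators_apolar[OF d1, of _ d2 G] g in blast)
  have "Ann f = Ann (\<Sum>r\<in>UNIV. mon (nagata_exp d1 G r))"
    by (simp add: f g xvar_power_eq_single umono_eq_single mult_single nagata_exp_def)
  \<comment> \<open>The common factorial required here is \<open>fact d1\<close>.\<close>
  also have "\<dots> = Collect (apolar (nagata_exp d1 G))"
    by (rule Ann_sum_single) (rule fact_exp_nagata_exp)
  also have "\<dots> = I"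
  proof (intro equalityI I_sub subsetI)
    fix \<alpha> :: "('i, 'j, 'k) bipoly"
    assume "\<alpha> \<in> Collect (apolar (nagata_exp d1 G))"
    then have "apolar (nagata_exp d1 G) \<alpha>" by simp
    then show "\<alpha> \<in> I"
    proof (rule apolar_in_ideal[OF I(1) I_sub inj_nagata_exp[OF d1], rotated -1])
      show "mon t \<in> I" if "\<And>r. \<not> exp_le t (nagata_exp d1 G r)" for t
        by (rule apolar_monomial_in_ideal[OF I[unfolded g] card that])
      show "mon (nagata_exp d1 G r - s) - mon (nagata_exp d1 G q - s) \<in> I"
        if "r \<noteq> q" "exp_le s (nagata_exp d1 G r)" "exp_le s (nagata_exp d1 G q)" for r q s
        by (rule apolar_pair_in_ideal[OF I[unfolded g] card that])
    qed
  qed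
  finally show ?thesis
    unfolding I_def nagata_generators_def .
qed

end
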